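(* Let $n\ge1$ and let $k:\mathbb R^n\to\mathbb R$ satisfy $k\in C(\mathbb R^n)\cap L^\infty(\mathbb R^n)$, $k\ge0$, $k(0)>0$, $\int_{\mathbb R^n}k(x)\,dx=1$. Then the following two statements are equivalent. (i) For all $1\le j\le n$, $$\int_{\mathbb R^n}x_jk(x)\,dx=0,\qquad \int_{\mathbb R^n}x_j^2k(x)\,dx=\frac1n\int_{\mathbb R^n}|x|^2k(x)\,dx<+\infty,$$ and for all $1\le j,h\le n$ with $j\ne h$, $\int_{\mathbb R^n}x_jx_hk(x)\,dx=0$. (ii) The Fourier transform of $k$ satisfies $$\hat k(\xi)=1-A|\xi|^2+o(|\xi|^2)\quad\text{as }\xi\to0,$$ where $A>0$ is the (finite) constant $$A=\frac1{2n}\int_{\mathbb R^n}|x|^2k(x)\,dx.$$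
   Context: The Fourier transform is $\hat k(\xi)=\int_{\mathbb R^n}e^{-ix\cdot\xi}k(x)\,dx$, $\xi\in\mathbb R^n$. *)

theory Defs
  imports "HOL-Analysis.Analysis" "HOL-Library.Landau_Symbols"
begin

definition fourier_transform :: "(real ^ 'n \<Rightarrow> real) \<Rightarrow> real ^ 'n \<Rightarrow> complex" where
  "fourier_transform k \<xi> =
     (\<integral>x. exp (- \<i> * complex_of_real (x \<bullet> \<xi>)) * complex_of_real (k x) \<partial>lborel)"

end

theory Submission
  imports Defs "HOL-Probability.Characteristic_Functions"
begin

text \<open>
  The Fourier transform encodes moments in its Taylor expansion at the origin. If \<open>|x|\<^sup>2 k\<close> is
  integrable, write \<open>L \<xi> = \<integral> (x \<bullet> \<xi>) k\<close> and \<open>Q \<xi> = \<integral> (x \<bullet> \<xi>)\<^sup>2 k\<close>. Integrating the second-order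
  Taylor expansion of \<open>exp (- \<i> t)\<close> at \<open>t = x \<bullet> \<xi>\<close> against \<open>k\<close> shows that the transform of \<open>k\<close> at \<open>\<xi>\<close> is
  \<open>\<integral> k - \<i> L \<xi> - Q \<xi> / 2 + o(|\<xi>|\<^sup>2)\<close> (\<open>fourier_transform_expansion\<close>). Only two moments are assumed
  finite, so the cubic Taylor bound cannot be integrated; it serves for pointwise convergence, while
  the quadratic bound supplies a dominating function.

  As the mass of \<open>k\<close> is 1, the expansion in (ii) therefore says that
  \<open>(A |\<xi>|\<^sup>2 - Q \<xi> / 2) - \<i> L \<xi>\<close> is \<open>o(|\<xi>|\<^sup>2)\<close>. The real part is homogeneous of degree 2 and the imaginary
  part of degree 1, so along each ray neither can be \<open>o(|\<xi>|\<^sup>2)\<close> unless it vanishes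
  (\<open>smallo_norm_sq_homogeneous_iff\<close>). Hence (ii) amounts to the identities \<open>L = 0\<close> and
  \<open>Q \<xi> = 2 A |\<xi>|\<^sup>2\<close> for all \<open>\<xi>\<close>. The coefficients of the forms \<open>L\<close> and \<open>Q\<close> are the first and second
  moments of \<open>k\<close>, and comparing coefficients turns the two identities into (i). Finally, \<open>A > 0\<close>
  holds in either case because a density with nonzero mass is not concentrated at the origin.
\<close>

section \<open>Integrability and positivity of moments\<close>

lemma integrable_inner_times:
  fixes k :: "'a::euclidean_space \<Rightarrow> real"
  assumes "integrable lborel k" "integrable lborel (\<lambda>x. (norm x)\<^sup>2 * k x)"
  shows "integrable lborel (\<lambda>x. (x \<bullet> u) * k x)"
    and "integrable lborel (\<lambda>x. (x \<bullet> u) * (x \<bullet> v) * k x)"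
proof -
  have [measurable]: "k \<in> borel_measurable borel"
    using borel_measurable_integrable[OF assms(1)] by simp
  show "integrable lborel (\<lambda>x. (x \<bullet> u) * k x)"
  proof (rule Bochner_Integration.integrable_bound)
    show "integrable lborel (\<lambda>x. norm u * (k x + (norm x)\<^sup>2 * k x))"
      using assms by (intro integrable_mult_right Bochner_Integration.integrable_add)
    show "AE x in lborel. norm ((x \<bullet> u) * k x) \<le> norm (norm u * (k x + (norm x)\<^sup>2 * k x))"
    proof (rule AE_I2)
      fix x :: 'a
      have "0 \<le> (norm x - 1)\<^sup>2 + (norm x)\<^sup>2 + 1" by simp
      then have "norm x \<le> 1 + (norm x)\<^sup>2" by (simp add: power2_eq_square algebra_simps)
      then have "\<bar>x \<bullet> u\<bar> \<le> (1 + (norm x)\<^sup>2) * norm u"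
        by (rule order_trans[OF Cauchy_Schwarz_ineq2 mult_right_mono]) simp
      then have "\<bar>x \<bullet> u\<bar> * \<bar>k x\<bar> \<le> (1 + (norm x)\<^sup>2) * norm u * \<bar>k x\<bar>"
        by (rule mult_right_mono) simp
      moreover have "k x + (norm x)\<^sup>2 * k x = (1 + (norm x)\<^sup>2) * k x"
        by (simp add: algebra_simps)
      ultimately show "norm ((x \<bullet> u) * k x) \<le> norm (norm u * (k x + (norm x)\<^sup>2 * k x))"
        by (simp add: abs_mult mult_ac)
    qed
  qed simp
  show "integrable lborel (\<lambda>x. (x \<bullet> u) * (x \<bullet> v) * k x)"
  proof (rule Bochner_Integration.integrable_bound)
    show "integrable lborel (\<lambda>x. (norm u * norm v) * ((norm x)\<^sup>2 * k x))"
      using assms(2) by (rule integrable_mult_right)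
    show "AE x in lborel. norm ((x \<bullet> u) * (x \<bullet> v) * k x)
        \<le> norm ((norm u * norm v) * ((norm x)\<^sup>2 * k x))"
    proof (rule AE_I2)
      fix x :: 'a
      have "\<bar>x \<bullet> u\<bar> * \<bar>x \<bullet> v\<bar> \<le> (norm x * norm u) * (norm x * norm v)"
        by (intro mult_mono Cauchy_Schwarz_ineq2) auto
      then have "\<bar>x \<bullet> u\<bar> * \<bar>x \<bullet> v\<bar> * \<bar>k x\<bar> \<le> (norm x * norm u) * (norm x * norm v) * \<bar>k x\<bar>"
        by (rule mult_right_mono) simp
      then show "norm ((x \<bullet> u) * (x \<bullet> v) * k x) \<le> norm ((norm u * norm v) * ((norm x)\<^sup>2 * k x))"
        by (simp add: abs_mult power2_eq_square mult_ac)
    qed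
  qed simp
qed

lemma second_moment_pos:
  fixes k :: "'a::euclidean_space \<Rightarrow> real"
  assumes nonneg: "\<And>x. 0 \<le> k x" and mass: "(\<integral>x. k x \<partial>lborel) \<noteq> 0"
    and k2: "integrable lborel (\<lambda>x. (norm x)\<^sup>2 * k x)"
  shows "0 < (\<integral>x. (norm x)\<^sup>2 * k x \<partial>lborel)"
proof -
  have "(\<integral>x. (norm x)\<^sup>2 * k x \<partial>lborel) \<noteq> 0"
  proof
    assume "(\<integral>x. (norm x)\<^sup>2 * k x \<partial>lborel) = 0"
    then have "AE x in lborel. (norm x)\<^sup>2 * k x = 0"
      using integral_nonneg_eq_0_iff_AE[OF k2] nonneg by simp
    then have "AE x in lborel. k x = 0"
      using AE_lborel_singleton[of 0] by eventually_elim simp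
    then have "(\<integral>x. k x \<partial>lborel) = 0"
      by (rule integral_eq_zero_AE)
    with mass show False ..
  qed
  moreover have "0 \<le> (\<integral>x. (norm x)\<^sup>2 * k x \<partial>lborel)"
    using nonneg by (intro integral_nonneg_AE) simp
  ultimately show ?thesis by linarith
qed

section \<open>Second-order expansion of the Fourier transform\<close>

text \<open>
  Taylor's theorem with remainder of order 3 and of order 2. The bound by \<open>t\<^sup>2\<close> is the one that can
  be integrated against a density with two finite moments.
\<close>
lemma norm_exp_taylor2_bounds:
  fixes t :: real
  defines "r \<equiv> exp (- \<i> * complex_of_real t) - 1 + \<i> * t + t\<^sup>2 / 2"
  shows "norm r \<le> t\<^sup>2" "norm r \<le> \<bar>t\<bar> ^ 3 / 6"
proof -
  have r: "iexp (- t) - (\<Sum>k\<le>2. (\<i> * complex_of_real (- t)) ^ k / fact k) = r"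
    by (simp add: r_def numeral_2_eq_2 power_mult_distrib algebra_simps)
  show "norm r \<le> t\<^sup>2"
    using iexp_approx2[of "- t" 2] unfolding r by simp
  show "norm r \<le> \<bar>t\<bar> ^ 3 / 6"
    using iexp_approx1[of "- t" 2] unfolding r by (simp add: fact_numeral)
qed

text \<open>
  Divided by \<open>|\<xi>|\<^sup>2\<close>, the integrand is dominated by \<open>|x|\<^sup>2 |k x|\<close> through the quadratic bound on the
  remainder and tends to 0 for each fixed \<open>x\<close> through the cubic one, so dominated convergence along
  sequences applies.
\<close>
lemma integral_taylor2_remainder_smallo:
  fixes k :: "'a::euclidean_space \<Rightarrow> real"
  assumes k: "integrable lborel k" and k2: "integrable lborel (\<lambda>x. (norm x)\<^sup>2 * k x)"
  defines "r \<equiv> \<lambda>t::real. exp (- \<i> * complex_of_real t) - 1 + \<i> * t + t\<^sup>2 / 2"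
  shows "(\<lambda>\<xi>. \<integral>x. r (x \<bullet> \<xi>) * k x \<partial>lborel) \<in> o[at 0](\<lambda>\<xi>. complex_of_real ((norm \<xi>)\<^sup>2))"
proof (rule smalloI_tendsto)
  have km [measurable]: "k \<in> borel_measurable borel"
    using borel_measurable_integrable[OF k] by simp
  have rm [measurable]: "r \<in> borel_measurable borel"
    unfolding r_def by measurable
  show "((\<lambda>\<xi>. (\<integral>x. r (x \<bullet> \<xi>) * k x \<partial>lborel) / complex_of_real ((norm \<xi>)\<^sup>2)) \<longlongrightarrow> 0) (at 0)"
    unfolding tendsto_at_iff_sequentially comp_def
  proof (intro allI impI)
    fix X :: "nat \<Rightarrow> 'a"
    assume X: "\<forall>i. X i \<in> UNIV - {0}" and X0: "X \<longlonglongrightarrow> 0"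
    let ?s = "\<lambda>n x. r (x \<bullet> X n) * k x / complex_of_real ((norm (X n))\<^sup>2)"
    have "(\<lambda>n. \<integral>x. ?s n x \<partial>lborel) \<longlonglongrightarrow> (\<integral>x. 0 \<partial>(lborel :: 'a measure))"
    proof (rule integral_dominated_convergence)
      show "integrable lborel (\<lambda>x. norm ((norm x)\<^sup>2 * k x))" using k2 by (rule integrable_norm)
      show "(\<lambda>x. 0) \<in> borel_measurable lborel" by simp
      show "?s n \<in> borel_measurable lborel" for n by measurable
      show "AE x in lborel. norm (?s n x) \<le> norm ((norm x)\<^sup>2 * k x)" for n
      proof (rule AE_I2)
        fix x :: 'a
        have pos: "(norm (X n))\<^sup>2 > 0" using X by simp
        have "norm (r (x \<bullet> X n)) \<le> (x \<bullet> X n)\<^sup>2"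
          unfolding r_def by (rule norm_exp_taylor2_bounds)
        also have "\<dots> \<le> (norm x * norm (X n))\<^sup>2"
          by (rule abs_le_square_iff[THEN iffD1]) (simp add: Cauchy_Schwarz_ineq2)
        finally have "norm (r (x \<bullet> X n)) / (norm (X n))\<^sup>2 \<le> (norm x)\<^sup>2"
          using pos by (simp add: pos_divide_le_eq power_mult_distrib)
        then have "norm (r (x \<bullet> X n)) / (norm (X n))\<^sup>2 * \<bar>k x\<bar> \<le> (norm x)\<^sup>2 * \<bar>k x\<bar>"
          by (rule mult_right_mono) simp
        then show "norm (?s n x) \<le> norm ((norm x)\<^sup>2 * k x)"
          by (simp add: norm_mult norm_divide norm_power abs_mult)
      qed
      show "AE x in lborel. (\<lambda>n. ?s n x) \<longlonglongrightarrow> 0"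
      proof (rule AE_I2)
        fix x :: 'a
        show "(\<lambda>n. ?s n x) \<longlonglongrightarrow> 0"
        proof (rule Lim_null_comparison)
          have "(\<lambda>n. norm x ^ 3 * norm (X n) * \<bar>k x\<bar> / 6) \<longlonglongrightarrow> norm x ^ 3 * norm (0::'a) * \<bar>k x\<bar> / 6"
            by (intro tendsto_intros X0) simp
          then show "(\<lambda>n. norm x ^ 3 * norm (X n) * \<bar>k x\<bar> / 6) \<longlonglongrightarrow> 0" by simp
          show "\<forall>\<^sub>F n in sequentially. norm (?s n x) \<le> norm x ^ 3 * norm (X n) * \<bar>k x\<bar> / 6"
          proof (rule always_eventually, rule allI)
            fix n
            have pos: "(norm (X n))\<^sup>2 > 0" using X by simp
            have "norm (r (x \<bullet> X n)) \<le> \<bar>x \<bullet> X n\<bar> ^ 3 / 6"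
              unfolding r_def by (rule norm_exp_taylor2_bounds)
            also have "\<dots> \<le> (norm x * norm (X n)) ^ 3 / 6"
              by (intro divide_right_mono power_mono Cauchy_Schwarz_ineq2) auto
            also have "\<dots> = (norm x ^ 3 * norm (X n) / 6) * (norm (X n))\<^sup>2"
              by (simp add: power_mult_distrib power2_eq_square power3_eq_cube)
            finally have "norm (r (x \<bullet> X n)) / (norm (X n))\<^sup>2 \<le> norm x ^ 3 * norm (X n) / 6"
              by (subst pos_divide_le_eq[OF pos])
            then have "norm (r (x \<bullet> X n)) / (norm (X n))\<^sup>2 * \<bar>k x\<bar>
                \<le> norm x ^ 3 * norm (X n) / 6 * \<bar>k x\<bar>"
              by (rule mult_right_mono) simp
            then show "norm (?s n x) \<le> norm x ^ 3 * norm (X n) * \<bar>k x\<bar> / 6"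
              by (simp add: norm_mult norm_divide norm_power)
          qed
        qed
      qed
    qed
    then show "(\<lambda>n. (\<integral>x. r (x \<bullet> X n) * k x \<partial>lborel) / complex_of_real ((norm (X n))\<^sup>2)) \<longlonglongrightarrow> 0"
      by simp
  qed
  show "\<forall>\<^sub>F \<xi> in at (0::'a). complex_of_real ((norm \<xi>)\<^sup>2) \<noteq> 0"
    by (simp add: eventually_at_filter)
qed

lemma fourier_transform_expansion:
  fixes k :: "real ^ 'n \<Rightarrow> real"
  assumes k: "integrable lborel k" and k2: "integrable lborel (\<lambda>x. (norm x)\<^sup>2 * k x)"
  shows "(\<lambda>\<xi>. fourier_transform k \<xi> - (complex_of_real (\<integral>x. k x \<partial>lborel)
             - \<i> * complex_of_real (\<integral>x. (x \<bullet> \<xi>) * k x \<partial>lborel)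
             - complex_of_real (\<integral>x. (x \<bullet> \<xi>)\<^sup>2 * k x \<partial>lborel) / 2))
           \<in> o[at 0](\<lambda>\<xi>. complex_of_real ((norm \<xi>)\<^sup>2))"
proof -
  have [measurable]: "k \<in> borel_measurable borel"
    using borel_measurable_integrable[OF k] by simp
  define r where "r = (\<lambda>t::real. exp (- \<i> * complex_of_real t) - 1 + \<i> * t + t\<^sup>2 / 2)"
  have "(\<integral>x. r (x \<bullet> \<xi>) * k x \<partial>lborel) = fourier_transform k \<xi> -
           (complex_of_real (\<integral>x. k x \<partial>lborel)
             - \<i> * complex_of_real (\<integral>x. (x \<bullet> \<xi>) * k x \<partial>lborel)
             - complex_of_real (\<integral>x. (x \<bullet> \<xi>)\<^sup>2 * k x \<partial>lborel) / 2)" for \<xi>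
  proof -
    let ?e = "\<lambda>x. exp (- \<i> * complex_of_real (x \<bullet> \<xi>)) * complex_of_real (k x)"
    have ie: "integrable lborel ?e"
    proof (rule Bochner_Integration.integrable_bound[OF k])
      show "AE x in lborel. norm (?e x) \<le> norm (k x)" by (simp add: norm_mult)
    qed simp
    have i0: "integrable lborel (\<lambda>x. complex_of_real (k x))" using k by simp
    have i1: "integrable lborel (\<lambda>x. \<i> * complex_of_real ((x \<bullet> \<xi>) * k x))"
      using integrable_inner_times(1)[OF k k2, of \<xi>] by (intro integrable_mult_right integrable_of_real)
    have i2: "integrable lborel (\<lambda>x. complex_of_real ((x \<bullet> \<xi>)\<^sup>2 * k x) / 2)"
      using integrable_inner_times(2)[OF k k2, of \<xi> \<xi>]
      by (intro integrable_divide integrable_of_real) (simp add: power2_eq_square)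
    have "(\<integral>x. r (x \<bullet> \<xi>) * k x \<partial>lborel) =
        (\<integral>x. (?e x - complex_of_real (k x) + \<i> * complex_of_real ((x \<bullet> \<xi>) * k x))
          + complex_of_real ((x \<bullet> \<xi>)\<^sup>2 * k x) / 2 \<partial>lborel)"
      by (rule Bochner_Integration.integral_cong) (simp_all add: r_def algebra_simps)
    also have "\<dots> = (\<integral>x. ?e x \<partial>lborel) - (\<integral>x. complex_of_real (k x) \<partial>lborel)
          + (\<integral>x. \<i> * complex_of_real ((x \<bullet> \<xi>) * k x) \<partial>lborel)
          + (\<integral>x. complex_of_real ((x \<bullet> \<xi>)\<^sup>2 * k x) / 2 \<partial>lborel)"
      using ie i0 i1 i2
      by (simp only: Bochner_Integration.integral_add Bochner_Integration.integral_diff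
          Bochner_Integration.integrable_add Bochner_Integration.integrable_diff)
    also have "\<dots> = fourier_transform k \<xi> -
           (complex_of_real (\<integral>x. k x \<partial>lborel)
             - \<i> * complex_of_real (\<integral>x. (x \<bullet> \<xi>) * k x \<partial>lborel)
             - complex_of_real (\<integral>x. (x \<bullet> \<xi>)\<^sup>2 * k x \<partial>lborel) / 2)"
      by (simp only: integral_mult_right_zero integral_divide_zero integral_complex_of_real
          fourier_transform_def) simp
    finally show ?thesis .
  qed
  with integral_taylor2_remainder_smallo[OF k k2] show ?thesis
    unfolding r_def by simp
qed

section \<open>Homogeneous forms and their coefficients\<close>

text \<open>
  On the ray \<open>t \<mapsto> t \<xi>\<close> the quotient by \<open>|t \<xi>|\<^sup>2\<close> has constant real part \<open>b \<xi> / |\<xi>|\<^sup>2\<close> and imaginary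
  part proportional to \<open>1 / t\<close>; both tend to 0 only if their coefficients vanish.
\<close>
lemma smallo_norm_sq_homogeneous_iff:
  fixes a b :: "'a::real_normed_vector \<Rightarrow> real"
  assumes a: "\<And>t \<xi>. a (t *\<^sub>R \<xi>) = t * a \<xi>" and b: "\<And>t \<xi>. b (t *\<^sub>R \<xi>) = t\<^sup>2 * b \<xi>"
  shows "(\<lambda>\<xi>. complex_of_real (b \<xi>) + \<i> * complex_of_real (a \<xi>))
            \<in> o[at 0](\<lambda>\<xi>. complex_of_real ((norm \<xi>)\<^sup>2))
         \<longleftrightarrow> (\<forall>\<xi>. a \<xi> = 0 \<and> b \<xi> = 0)" (is "?f \<in> o[at 0](?g) \<longleftrightarrow> _")
proof
  assume small: "?f \<in> o[at 0](?g)"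
  show "\<forall>\<xi>. a \<xi> = 0 \<and> b \<xi> = 0"
  proof
    fix \<xi> :: 'a
    show "a \<xi> = 0 \<and> b \<xi> = 0"
    proof (cases "\<xi> = 0")
      case True
      then show ?thesis using a[of 0 0] b[of 0 0] by simp
    next
      case False
      have "((\<lambda>t. t *\<^sub>R \<xi>) \<longlongrightarrow> 0 *\<^sub>R \<xi>) (at (0::real))" by (intro tendsto_intros)
      moreover have "\<forall>\<^sub>F t in at (0::real). t *\<^sub>R \<xi> \<noteq> 0"
        using False by (simp add: eventually_at_filter)
      ultimately have "filterlim (\<lambda>t. t *\<^sub>R \<xi>) (at 0) (at (0::real))"
        by (simp add: filterlim_at)
      from filterlim_compose[OF smalloD_tendsto[OF small] this]
      have lim: "((\<lambda>t::real. ?f (t *\<^sub>R \<xi>) / ?g (t *\<^sub>R \<xi>)) \<longlongrightarrow> 0) (at 0)" .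
      have ne: "\<forall>\<^sub>F t in at (0::real). t \<noteq> 0" by (simp add: eventually_at_filter)
      have "((\<lambda>t::real. b \<xi> / (norm \<xi>)\<^sup>2) \<longlongrightarrow> 0) (at 0)"
      proof (rule Lim_transform_eventually)
        show "((\<lambda>t::real. Re (?f (t *\<^sub>R \<xi>) / ?g (t *\<^sub>R \<xi>))) \<longlongrightarrow> 0) (at 0)"
          using tendsto_Re[OF lim] by simp
        show "\<forall>\<^sub>F t in at (0::real). Re (?f (t *\<^sub>R \<xi>) / ?g (t *\<^sub>R \<xi>)) = b \<xi> / (norm \<xi>)\<^sup>2"
          using ne by eventually_elim (simp add: a b Re_divide_of_real power_mult_distrib
              del: of_real_power of_real_mult)
      qed
      then have "b \<xi> / (norm \<xi>)\<^sup>2 = 0" by (simp add: tendsto_const_iff)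
      moreover have "((\<lambda>t::real. a \<xi> / (norm \<xi>)\<^sup>2) \<longlongrightarrow> 0) (at 0)"
      proof (rule Lim_transform_eventually)
        \<comment> \<open>The imaginary part of the quotient is \<open>a \<xi> / (t |\<xi>|\<^sup>2)\<close>; the factor \<open>t\<close> makes it constant.\<close>
        show "((\<lambda>t::real. t * Im (?f (t *\<^sub>R \<xi>) / ?g (t *\<^sub>R \<xi>))) \<longlongrightarrow> 0) (at 0)"
          using tendsto_mult[OF tendsto_ident_at tendsto_Im[OF lim]] by simp
        show "\<forall>\<^sub>F t in at (0::real). t * Im (?f (t *\<^sub>R \<xi>) / ?g (t *\<^sub>R \<xi>)) = a \<xi> / (norm \<xi>)\<^sup>2"
          using ne by eventually_elim (simp add: a b Im_divide_of_real power_mult_distrib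
              del: of_real_power of_real_mult, simp add: power2_eq_square)
      qed
      then have "a \<xi> / (norm \<xi>)\<^sup>2 = 0" by (simp add: tendsto_const_iff)
      ultimately show ?thesis using False by simp
    qed
  qed
qed simp

lemma linear_form_eq_0_iff:
  fixes m :: "'n::finite \<Rightarrow> real"
  shows "(\<forall>\<xi>::real^'n. (\<Sum>j\<in>UNIV. m j * \<xi> $ j) = 0) \<longleftrightarrow> (\<forall>j. m j = 0)"
proof (intro iffI allI)
  fix j
  assume "\<forall>\<xi>::real^'n. (\<Sum>j\<in>UNIV. m j * \<xi> $ j) = 0"
  from spec[OF this, of "axis j 1"] show "m j = 0"
    by (simp add: axis_def if_distrib sum.delta cong: if_cong)
qed simp

text \<open>
  Testing with a unit vector gives the diagonal coefficients. Testing with a sum of two distinct unit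
  vectors then gives \<open>C j h + C h j\<close>, which by symmetry determines the off-diagonal ones.
\<close>
lemma quadratic_form_eq_norm_sq_iff:
  fixes C :: "'n::finite \<Rightarrow> 'n \<Rightarrow> real"
  assumes sym: "\<And>j h. C j h = C h j"
  shows "(\<forall>\<xi>::real^'n. (\<Sum>j\<in>UNIV. \<Sum>h\<in>UNIV. C j h * (\<xi> $ j * \<xi> $ h)) = c * (norm \<xi>)\<^sup>2)
     \<longleftrightarrow> (\<forall>j. C j j = c) \<and> (\<forall>j h. j \<noteq> h \<longrightarrow> C j h = 0)"
proof -
  define q where "q \<xi> = (\<Sum>j\<in>UNIV. \<Sum>h\<in>UNIV. C j h * (\<xi> $ j * \<xi> $ h))" for \<xi> :: "real^'n"
  have norm_sq: "(norm \<xi>)\<^sup>2 = (\<Sum>j\<in>UNIV. (\<xi> $ j)\<^sup>2)" for \<xi> :: "real^'n"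
    unfolding power2_norm_eq_inner inner_vec_def by (simp add: power2_eq_square)
  have axis_sum: "(\<Sum>h\<in>UNIV. f h * (axis b 1 :: real^'n) $ h) = f b" for f and b :: 'n
    by (simp add: axis_def if_distrib sum.delta cong: if_cong)
  have axes: "(\<Sum>i\<in>UNIV. \<Sum>h\<in>UNIV. C i h * ((axis a 1 :: real^'n) $ i * (axis b 1 :: real^'n) $ h)) = C a b"
    for a b
    by (simp only: mult.assoc[symmetric] axis_sum)
  have "(\<forall>\<xi>. q \<xi> = c * (norm \<xi>)\<^sup>2) \<longleftrightarrow> (\<forall>j. C j j = c) \<and> (\<forall>j h. j \<noteq> h \<longrightarrow> C j h = 0)"
  proof (intro iffI conjI allI impI)
    assume q: "\<forall>\<xi>. q \<xi> = c * (norm \<xi>)\<^sup>2"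
    show diag: "C j j = c" for j
      using spec[OF q, of "axis j 1"] by (simp add: q_def axes)
    fix j h :: 'n
    assume "j \<noteq> h"
    have q': "q (axis j 1 + axis h 1) = C j j + C j h + (C h j + C h h)"
      by (simp add: q_def distrib_left distrib_right sum.distrib axes)
    have "(norm (axis j 1 + axis h 1 :: real^'n))\<^sup>2 = 2"
      using \<open>j \<noteq> h\<close> by (simp add: power2_norm_eq_inner inner_add_left inner_add_right inner_axis_axis)
    with q' q diag sym[of j h] show "C j h = 0" by simp
  next
    fix \<xi> :: "real^'n"
    assume C: "(\<forall>j. C j j = c) \<and> (\<forall>j h. j \<noteq> h \<longrightarrow> C j h = 0)"
    then have "C j h * (\<xi> $ j * \<xi> $ h) = (if j = h then c * (\<xi> $ j)\<^sup>2 else 0)" for j h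
      by (auto simp: power2_eq_square)
    then have "q \<xi> = (\<Sum>j\<in>UNIV. \<Sum>h\<in>UNIV. if j = h then c * (\<xi> $ j)\<^sup>2 else 0)"
      by (simp only: q_def)
    then show "q \<xi> = c * (norm \<xi>)\<^sup>2"
      by (simp add: norm_sq sum_distrib_left)
  qed
  then show ?thesis by (simp only: q_def)
qed

section \<open>Isotropic second moments and the Fourier transform\<close>

theorem proposition1p2:
  fixes k :: "real ^ 'n \<Rightarrow> real"
  assumes "continuous_on UNIV k"
    and "bounded (range k)"
    and "\<And>x. 0 \<le> k x"
    and "0 < k 0"
    and "integrable lborel k"
    and "(\<integral>x. k x \<partial>lborel) = 1"
  shows
    "((\<forall>j. integrable lborel (\<lambda>x. x $ j * k x) \<and>
           (\<integral>x. x $ j * k x \<partial>lborel) = 0) \<and>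
      integrable lborel (\<lambda>x. (norm x)\<^sup>2 * k x) \<and>
      (\<forall>j. integrable lborel (\<lambda>x. (x $ j)\<^sup>2 * k x) \<and>
           (\<integral>x. (x $ j)\<^sup>2 * k x \<partial>lborel) =
             1 / real CARD('n) * (\<integral>x. (norm x)\<^sup>2 * k x \<partial>lborel)) \<and>
      (\<forall>j h. j \<noteq> h \<longrightarrow>
           integrable lborel (\<lambda>x. x $ j * x $ h * k x) \<and>
           (\<integral>x. x $ j * x $ h * k x \<partial>lborel) = 0))
     \<longleftrightarrow>
     (let A = 1 / (2 * real CARD('n)) * (\<integral>x. (norm x)\<^sup>2 * k x \<partial>lborel) in
        integrable lborel (\<lambda>x. (norm x)\<^sup>2 * k x) \<and>
        A > 0 \<and>
        (\<lambda>\<xi>. fourier_transform k \<xi> - (1 - complex_of_real (A * (norm \<xi>)\<^sup>2)))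
          \<in> o[at 0](\<lambda>\<xi>. complex_of_real ((norm \<xi>)\<^sup>2)))"
proof -
  define M where "M = (\<integral>x. (norm x)\<^sup>2 * k x \<partial>lborel)"
  define m where "m = (\<lambda>j. \<integral>x. x $ j * k x \<partial>lborel)"
  define C where "C = (\<lambda>j h. \<integral>x. x $ j * x $ h * k x \<partial>lborel)"
  define A where "A = 1 / (2 * real CARD('n)) * M"
  note nonneg = assms(3) and k = assms(5) and mass = assms(6)
  \<comment> \<open>Both sides of the theorem include the integrability of \<open>|x|\<^sup>2 k\<close>, so the analysis may assume it.\<close>
  have equiv: "(\<forall>j. m j = 0) \<and> (\<forall>j. C j j = 2 * A) \<and> (\<forall>j h. j \<noteq> h \<longrightarrow> C j h = 0)
     \<longleftrightarrow> (\<lambda>\<xi>. fourier_transform k \<xi> - (1 - complex_of_real (A * (norm \<xi>)\<^sup>2)))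
          \<in> o[at 0](\<lambda>\<xi>. complex_of_real ((norm \<xi>)\<^sup>2))" (is "_ \<longleftrightarrow> ?F \<in> ?o")
    and int1: "integrable lborel (\<lambda>x. x $ j * k x)"
    and int2: "integrable lborel (\<lambda>x. x $ j * x $ h * k x)"
    and pos: "0 < A"
    if k2: "integrable lborel (\<lambda>x. (norm x)\<^sup>2 * k x)" for j h
  proof -
    show int1: "integrable lborel (\<lambda>x. x $ j * k x)" for j
      using integrable_inner_times(1)[OF k k2, of "axis j 1"] by (simp add: inner_axis)
    show int2: "integrable lborel (\<lambda>x. x $ j * x $ h * k x)" for j h
      using integrable_inner_times(2)[OF k k2, of "axis j 1" "axis h 1"] by (simp add: inner_axis)
    show "0 < A"
      using second_moment_pos[OF nonneg _ k2] mass by (simp add: A_def M_def)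
    define L where "L \<xi> = (\<integral>x. (x \<bullet> \<xi>) * k x \<partial>lborel)" for \<xi>
    define Q where "Q \<xi> = (\<integral>x. (x \<bullet> \<xi>)\<^sup>2 * k x \<partial>lborel)" for \<xi>
    have L: "L \<xi> = (\<Sum>j\<in>UNIV. m j * \<xi> $ j)" for \<xi>
    proof -
      have "L \<xi> = (\<integral>x. (\<Sum>j\<in>UNIV. x $ j * k x * \<xi> $ j) \<partial>lborel)"
        by (simp add: L_def inner_vec_def sum_distrib_left sum_distrib_right mult_ac)
      also have "\<dots> = (\<Sum>j\<in>UNIV. m j * \<xi> $ j)"
        unfolding m_def using int1 by (simp add: Bochner_Integration.integral_sum)
      finally show ?thesis .
    qed
    have Q: "Q \<xi> = (\<Sum>j\<in>UNIV. \<Sum>h\<in>UNIV. C j h * (\<xi> $ j * \<xi> $ h))" for \<xi>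
    proof -
      have "Q \<xi> = (\<integral>x. (\<Sum>j\<in>UNIV. \<Sum>h\<in>UNIV. x $ j * x $ h * k x * (\<xi> $ j * \<xi> $ h)) \<partial>lborel)"
        unfolding Q_def inner_vec_def power2_eq_square sum_product
        unfolding sum_distrib_right
        by (intro Bochner_Integration.integral_cong sum.cong refl) (simp add: mult_ac)
      also have "\<dots> = (\<Sum>j\<in>UNIV. \<Sum>h\<in>UNIV. C j h * (\<xi> $ j * \<xi> $ h))"
        unfolding C_def using int2 by (simp add: Bochner_Integration.integral_sum)
      finally show ?thesis .
    qed
    let ?P = "\<lambda>\<xi>. complex_of_real (A * (norm \<xi>)\<^sup>2 - Q \<xi> / 2) + \<i> * complex_of_real (- L \<xi>)"
    \<comment> \<open>\<open>?P\<close> is what the expansion of the transform leaves of \<open>?F\<close> up to an error \<open>R\<close> of lower order.\<close>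
    define R where "R \<xi> = ?F \<xi> - ?P \<xi>" for \<xi>
    have R: "R \<in> ?o"
      using fourier_transform_expansion[OF k k2]
      unfolding R_def[abs_def] mass L_def Q_def by (simp add: algebra_simps)
    have P: "?P = (\<lambda>\<xi>. ?F \<xi> - R \<xi>)"
      by (rule ext) (simp add: R_def)
    have F: "?F = (\<lambda>\<xi>. ?P \<xi> + R \<xi>)"
      by (rule ext) (simp add: R_def)
    have "?F \<in> ?o \<longleftrightarrow> ?P \<in> ?o"
    proof
      assume "?F \<in> ?o"
      from sum_in_smallo(2)[OF this R] show "?P \<in> ?o" unfolding P .
    next
      assume "?P \<in> ?o"
      from sum_in_smallo(1)[OF this R] show "?F \<in> ?o" unfolding F .
    qed
    also have "\<dots> \<longleftrightarrow> (\<forall>\<xi>. - L \<xi> = 0 \<and> A * (norm \<xi>)\<^sup>2 - Q \<xi> / 2 = 0)"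
    proof (rule smallo_norm_sq_homogeneous_iff)
      show "- L (t *\<^sub>R \<xi>) = t * - L \<xi>" for t \<xi>
        by (simp add: L_def mult.assoc)
      have "Q (t *\<^sub>R \<xi>) = t\<^sup>2 * Q \<xi>" for t \<xi>
        by (simp add: Q_def power_mult_distrib mult.assoc)
      then show "A * (norm (t *\<^sub>R \<xi>))\<^sup>2 - Q (t *\<^sub>R \<xi>) / 2 = t\<^sup>2 * (A * (norm \<xi>)\<^sup>2 - Q \<xi> / 2)" for t \<xi>
        by (simp add: power_mult_distrib algebra_simps)
    qed
    also have "\<dots> \<longleftrightarrow> (\<forall>\<xi>. L \<xi> = 0) \<and> (\<forall>\<xi>. Q \<xi> = 2 * A * (norm \<xi>)\<^sup>2)"
      by (auto simp: field_simps)
    also have "\<dots> \<longleftrightarrow> (\<forall>j. m j = 0) \<and> (\<forall>j. C j j = 2 * A) \<and> (\<forall>j h. j \<noteq> h \<longrightarrow> C j h = 0)"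
      unfolding L Q linear_form_eq_0_iff
      by (subst quadratic_form_eq_norm_sq_iff) (simp_all add: C_def mult_ac)
    finally show "(\<forall>j. m j = 0) \<and> (\<forall>j. C j j = 2 * A) \<and> (\<forall>j h. j \<noteq> h \<longrightarrow> C j h = 0)
        \<longleftrightarrow> ?F \<in> ?o" by (rule sym)
  qed
  have diag: "(\<lambda>x. (x $ j)\<^sup>2 * k x) = (\<lambda>x. x $ j * x $ j * k x)" for j
    by (simp add: power2_eq_square)
  have A2: "2 * A = 1 / real CARD('n) * M" by (simp add: A_def)
  show ?thesis
  proof (cases "integrable lborel (\<lambda>x. (norm x)\<^sup>2 * k x)")
    case True
    from equiv[OF True] show ?thesis
      unfolding Let_def M_def[symmetric] A_def[symmetric] diag
      unfolding m_def C_def A2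
      by (simp only: True pos[OF True] int1[OF True] int2[OF True] simp_thms)
  next
    case False
    then show ?thesis by (simp only: Let_def simp_thms)
  qed
qed

end
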